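(* Let $\xi\in\mathbb{R}$ and let $W$ denote the principal branch of the Lambert W function. On the set of $\alpha>0$ with $\xi e^{-1/\alpha}>-e^{-1}$ let $$\gamma(\alpha)=\alpha\left[1+W(\xi e^{-1/\alpha})\right],$$ which is a solution of $\gamma(\alpha)+\gamma(\alpha)(1-\alpha\partial_\alpha)\gamma(\alpha)=\alpha$. Define $\gamma_1:=\gamma$ and, recursively for $k\ge1$, $$(k+1)\gamma_{k+1}(\alpha)=\gamma(\alpha)(\alpha\partial_\alpha-1)\gamma_k(\alpha).$$ Then $$j!\,\gamma_j(\alpha)=\alpha W(\xi e^{-1/\alpha})\qquad\text{for all } j\ge2,$$ and the photon self-energy $\Sigma_\xi(\alpha,e^{L}):=\sum_{j\ge1}\gamma_j(\alpha)L^j$ is given by $$\Sigma_\xi(\alpha,e^{L})=\alpha L+\alpha(e^{L}-1)W(\xi e^{-1/\alpha}).$$ Equivalently, with $L=\ln(-q^2/\mu^2)$, $$\Sigma_\xi(\alpha,e^L)=\alpha\ln(-q^2/\mu^2)-\alpha\left(1+q^2/\mu^2\right)W(\xi e^{-1/\alpha}).$$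
   Context: The Lambert W function is the inverse of $x\mapsto xe^x$, characterized by $x=W(x)e^{W(x)}$; its principal branch is $W:[-1/e,\infty)\to[-1,\infty)$. Here $q^2<0$ is the squared momentum (Minkowski metric, mostly minus signature, spacelike photon) and $\mu^2>0$ the renormalization scale, so that $L$ is real. *)

theory Defs
  imports "HOL-Analysis.Analysis"
begin

text \<open>
  Principal branch of the Lambert W function: the inverse of \<open>w \<mapsto> w * exp w\<close> restricted to
  \<open>{-1..}\<close>. It is meaningful only on the image \<open>{- exp (-1)..}\<close>.
\<close>

definition lambert_W :: "real \<Rightarrow> real" where
  "lambert_W = the_inv_into {-1..} (\<lambda>w. w * exp w)"

lemma bij_betw_mult_exp:
  "bij_betw (\<lambda>w::real. w * exp w) {-1..} {- exp (-1)..}"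
proof -
  have der: "((\<lambda>w::real. w * exp w) has_real_derivative (1 + x) * exp x) (at x)" for x
    by (auto intro!: derivative_eq_intros simp: algebra_simps)
  have cont: "continuous_on S (\<lambda>w::real. w * exp w)" for S
    by (intro continuous_intros)
  have mono: "x * exp x < y * exp y" if "-1 \<le> x" "x < y" for x y :: real
  proof (rule DERIV_pos_imp_increasing_open[OF \<open>x < y\<close> _ cont])
    fix z assume "x < z" "z < y"
    with that have "(1 + z) * exp z > 0" by simp
    then show "\<exists>d. ((\<lambda>w. w * exp w) has_real_derivative d) (at z) \<and> d > 0"
      using der by blast
  qed
  have "inj_on (\<lambda>w::real. w * exp w) {-1..}"
    by (rule linorder_inj_onI) (auto dest: mono)
  moreover have "(\<lambda>w::real. w * exp w) ` {-1..} = {- exp (-1)..}"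
  proof (intro equalityI subsetI)
    fix y assume "y \<in> (\<lambda>w::real. w * exp w) ` {-1..}"
    then obtain w where w: "w \<ge> -1" "y = w * exp w" by auto
    then show "y \<in> {- exp (-1)..}"
      using mono[of "-1" w] by (cases "w = -1") auto
  next
    fix y :: real assume y: "y \<in> {- exp (-1)..}"
    have "y \<le> max 0 y * exp (max 0 y)"
    proof (cases "y \<ge> 0")
      case True
      then show ?thesis using mult_left_mono[of 1 "exp y" y] by simp
    qed simp
    moreover have "-1 \<le> max 0 y" by simp
    ultimately obtain w where "-1 \<le> w" "w * exp w = y"
      using IVT'[of "\<lambda>w. w * exp w" "-1" y "max 0 y", OF _ _ _ cont] y by auto
    then show "y \<in> (\<lambda>w::real. w * exp w) ` {-1..}" by force
  qed
  ultimately show ?thesis by (simp add: bij_betw_def)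
qed

lemma lambert_W:
  assumes "x \<ge> - exp (-1)"
  shows "lambert_W x \<ge> -1" and "lambert_W x * exp (lambert_W x) = x"
proof -
  have inj: "inj_on (\<lambda>w::real. w * exp w) {-1..}"
    and img: "x \<in> (\<lambda>w::real. w * exp w) ` {-1..}"
    using bij_betw_mult_exp assms by (auto simp: bij_betw_def)
  show "lambert_W x \<ge> -1"
    using the_inv_into_into[OF inj img order_refl] by (simp add: lambert_W_def)
  show "lambert_W x * exp (lambert_W x) = x"
    using f_the_inv_into_f[OF inj img] by (simp add: lambert_W_def)
qed

definition anom_dim :: "real \<Rightarrow> real \<Rightarrow> real" where
  "anom_dim \<xi> \<alpha> = \<alpha> * (1 + lambert_W (\<xi> * exp (- 1 / \<alpha>)))"

text \<open>
  The coefficients are indexed from 1; the value at index 0 is a dummy and never enters the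
  recursion or the series below.
\<close>

fun anom_coeff :: "real \<Rightarrow> nat \<Rightarrow> real \<Rightarrow> real" where
  "anom_coeff \<xi> 0 = (\<lambda>\<alpha>. 0)"
| "anom_coeff \<xi> (Suc 0) = anom_dim \<xi>"
| "anom_coeff \<xi> (Suc (Suc k)) =
     (\<lambda>\<alpha>. anom_dim \<xi> \<alpha> * (\<alpha> * deriv (anom_coeff \<xi> (Suc k)) \<alpha> - anom_coeff \<xi> (Suc k) \<alpha>)
            / real (Suc (Suc k)))"

text \<open>The third argument is \<open>exp L\<close>, so the expansion variable \<open>L\<close> is its logarithm.\<close>

definition self_energy :: "real \<Rightarrow> real \<Rightarrow> real \<Rightarrow> real" where
  "self_energy \<xi> \<alpha> x = (\<Sum>j. anom_coeff \<xi> (Suc j) \<alpha> * ln x ^ Suc j)"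

end

theory Submission
  imports Defs
begin

text \<open>
  Write w(a) for W(\<xi> exp(-1/a)). Since x W'(x) = W / (1 + W), we have a^2 w' = w / (1 + w).
  Hence the operator \<gamma> (a d/da - 1) maps \<gamma> = a (1 + w) to a w and fixes a w, so the
  recursion only produces the factorials, and the series is an exponential series with a modified
  linear term.
\<close>

lemma lambert_W_eqI:
  assumes "w \<ge> -1"
  shows "lambert_W (w * exp w) = w"
  unfolding lambert_W_def using bij_betw_mult_exp assms
  by (intro the_inv_into_f_f) (auto simp: bij_betw_def)

text \<open>The value -1 is taken only at the branch point \<open>- exp (-1)\<close>. Strictness
  keeps 1 + W nonzero, on which all later divisions rest.\<close>

lemma lambert_W_gt_minus_1:
  assumes "x > - exp (-1)"
  shows "lambert_W x > -1"
proof -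
  have "lambert_W x \<noteq> -1"
    using lambert_W(2)[of x] assms by auto
  then show ?thesis
    using lambert_W(1)[of x] assms by simp
qed

text \<open>Inverse function rule: \<open>w * exp w\<close> has slope
  \<open>(1 + w) * exp w\<close>, which is nonzero for w > -1. Unlike W / (x (1 + W)), this form
  also covers x = 0.\<close>

lemma has_real_derivative_lambert_W:
  assumes x: "x > - exp (-1)"
  shows "(lambert_W has_real_derivative inverse ((1 + lambert_W x) * exp (lambert_W x))) (at x)"
proof -
  let ?f = "\<lambda>w::real. w * exp w"
  define w where "w = lambert_W x"
  have w: "w > -1" and fw: "?f w = x"
    using lambert_W_gt_minus_1[OF x] lambert_W(2)[of x] x by (simp_all add: w_def)
  \<comment> \<open>The point w is interior to [-1, w + 1], where \<open>lambert_W\<close> is a left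
    inverse of the continuous map \<open>?f\<close>; the right end only has to exceed w.\<close>
  have "isCont lambert_W (?f w)"
    by (rule isCont_inverse_function2[where a = "-1" and b = "w + 1"])
       (use w in \<open>auto intro!: lambert_W_eqI\<close>)
  then have cont: "isCont lambert_W x"
    by (simp add: fw)
  have der: "(?f has_real_derivative (1 + w) * exp w) (at w)"
    by (auto intro!: derivative_eq_intros simp: algebra_simps)
  show ?thesis
    unfolding w_def[symmetric]
    by (rule DERIV_inverse_function[where f = ?f and a = "- exp (-1)" and b = "x + 1"])
       (use der w x cont in \<open>auto simp: w_def lambert_W(2)\<close>)
qed

definition anom_domain :: "real \<Rightarrow> real set" where
  "anom_domain \<xi> = {\<alpha>. \<alpha> > 0 \<and> \<xi> * exp (- 1 / \<alpha>) > - exp (- 1)}"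

definition anom_W :: "real \<Rightarrow> real \<Rightarrow> real" where
  "anom_W \<xi> \<alpha> = lambert_W (\<xi> * exp (- 1 / \<alpha>))"

lemma anom_dim_eq: "anom_dim \<xi> \<alpha> = \<alpha> * (1 + anom_W \<xi> \<alpha>)"
  by (simp add: anom_dim_def anom_W_def)

text \<open>Openness allows an identity valid on the whole domain to be differentiated at each of
  its points.\<close>

lemma open_anom_domain: "open (anom_domain \<xi>)"
proof -
  have "continuous_on {0<..} (\<lambda>\<alpha>::real. \<xi> * exp (- 1 / \<alpha>))"
    by (intro continuous_intros) auto
  then have "open ({0<..} \<inter> (\<lambda>\<alpha>. \<xi> * exp (- 1 / \<alpha>)) -` {- exp (-1)<..})"
    by (rule continuous_open_preimage) auto
  also have "{0<..} \<inter> (\<lambda>\<alpha>. \<xi> * exp (- 1 / \<alpha>)) -` {- exp (-1)<..} = anom_domain \<xi>"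
    by (auto simp: anom_domain_def)
  finally show ?thesis .
qed

lemma anom_domain_gt_0: "\<alpha> \<in> anom_domain \<xi> \<Longrightarrow> \<alpha> > 0"
  by (simp add: anom_domain_def)

lemma anom_W_gt_minus_1: "\<alpha> \<in> anom_domain \<xi> \<Longrightarrow> anom_W \<xi> \<alpha> > -1"
  by (simp add: anom_domain_def anom_W_def lambert_W_gt_minus_1)

lemma has_real_derivative_anom_W:
  assumes "\<alpha> \<in> anom_domain \<xi>"
  shows "(anom_W \<xi> has_real_derivative anom_W \<xi> \<alpha> / (\<alpha>\<^sup>2 * (1 + anom_W \<xi> \<alpha>))) (at \<alpha>)"
proof -
  define x where "x = \<xi> * exp (- 1 / \<alpha>)"
  define w where "w = lambert_W x"
  have pos: "\<alpha> > 0" and x: "x > - exp (-1)"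
    using assms by (auto simp: anom_domain_def x_def)
  have w: "w > -1" "w * exp w = x"
    using lambert_W_gt_minus_1[OF x] lambert_W(2)[of x] x by (auto simp: w_def)
  have "((\<lambda>\<alpha>. \<xi> * exp (- 1 / \<alpha>)) has_real_derivative x / \<alpha>\<^sup>2) (at \<alpha>)"
    unfolding x_def using pos
    by (auto intro!: derivative_eq_intros simp: field_simps power2_eq_square)
  from DERIV_chain2[OF has_real_derivative_lambert_W[OF x, unfolded x_def] this]
  have "(anom_W \<xi> has_real_derivative inverse ((1 + w) * exp w) * (x / \<alpha>\<^sup>2)) (at \<alpha>)"
    by (simp add: anom_W_def[abs_def] w_def x_def)
  \<comment> \<open>Writing x as \<open>w * exp w\<close> cancels the exponential.\<close>
  also have "inverse ((1 + w) * exp w) * (x / \<alpha>\<^sup>2) = w / (\<alpha>\<^sup>2 * (1 + w))"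
    using w(1) pos unfolding w(2)[symmetric] by (simp add: divide_simps)
  finally show ?thesis
    by (simp add: w_def x_def anom_W_def[abs_def])
qed

lemma has_real_derivative_mult_anom_W:
  assumes "\<alpha> \<in> anom_domain \<xi>"
  shows "((\<lambda>\<alpha>. \<alpha> * anom_W \<xi> \<alpha>) has_real_derivative
           anom_W \<xi> \<alpha> + anom_W \<xi> \<alpha> / (\<alpha> * (1 + anom_W \<xi> \<alpha>))) (at \<alpha>)"
proof -
  have "anom_W \<xi> \<alpha> / (\<alpha>\<^sup>2 * (1 + anom_W \<xi> \<alpha>)) * \<alpha> = anom_W \<xi> \<alpha> / (\<alpha> * (1 + anom_W \<xi> \<alpha>))"
    using anom_domain_gt_0[OF assms] by (simp add: power2_eq_square)
  then show ?thesis
    using DERIV_mult[OF DERIV_ident has_real_derivative_anom_W[OF assms]] by simp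
qed

lemma has_real_derivative_anom_dim:
  assumes "\<alpha> \<in> anom_domain \<xi>"
  shows "(anom_dim \<xi> has_real_derivative
           1 + anom_W \<xi> \<alpha> + anom_W \<xi> \<alpha> / (\<alpha> * (1 + anom_W \<xi> \<alpha>))) (at \<alpha>)"
proof -
  have "anom_dim \<xi> = (\<lambda>\<alpha>. \<alpha> + \<alpha> * anom_W \<xi> \<alpha>)"
    by (auto simp: anom_dim_eq algebra_simps)
  then show ?thesis
    using DERIV_add[OF DERIV_ident has_real_derivative_mult_anom_W[OF assms]]
    by (simp add: add.assoc)
qed

text \<open>With w = \<open>anom_W \<xi> \<alpha>\<close>, the difference collapses to w / (1 + w),
  and \<gamma> = \<alpha> (1 + w) cancels the denominator. The derivative of \<alpha> w is written
  out so that the identity also serves for \<gamma> and for multiples of \<alpha> w.\<close>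

lemma anom_dim_operator_mult_anom_W:
  assumes "\<alpha> \<in> anom_domain \<xi>"
  shows "anom_dim \<xi> \<alpha> * (\<alpha> * (anom_W \<xi> \<alpha> + anom_W \<xi> \<alpha> / (\<alpha> * (1 + anom_W \<xi> \<alpha>)))
           - \<alpha> * anom_W \<xi> \<alpha>) = \<alpha> * anom_W \<xi> \<alpha>"
proof -
  have "\<alpha> \<noteq> 0" "1 + anom_W \<xi> \<alpha> \<noteq> 0"
    using anom_domain_gt_0[OF assms] anom_W_gt_minus_1[OF assms] by auto
  then show ?thesis
    by (simp add: anom_dim_eq distrib_left[of \<alpha> \<open>anom_W \<xi> \<alpha>\<close>])
qed

text \<open>\<gamma> and \<alpha> w differ by \<alpha>, which \<alpha> d/d\<alpha> - 1 annihilates,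
  so both have the same image.\<close>

lemma anom_dim_operator_anom_dim:
  assumes "\<alpha> \<in> anom_domain \<xi>"
  shows "anom_dim \<xi> \<alpha> * (\<alpha> * deriv (anom_dim \<xi>) \<alpha> - anom_dim \<xi> \<alpha>) = \<alpha> * anom_W \<xi> \<alpha>"
proof -
  have "\<alpha> * deriv (anom_dim \<xi>) \<alpha> - anom_dim \<xi> \<alpha> =
          \<alpha> * (anom_W \<xi> \<alpha> + anom_W \<xi> \<alpha> / (\<alpha> * (1 + anom_W \<xi> \<alpha>))) - \<alpha> * anom_W \<xi> \<alpha>"
    unfolding DERIV_imp_deriv[OF has_real_derivative_anom_dim[OF assms]]
    by (simp add: anom_dim_eq algebra_simps)
  then show ?thesis
    using anom_dim_operator_mult_anom_W[OF assms] by simp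
qed

text \<open>The closed form is assumed on the whole open domain because a derivative depends on a
  neighbourhood. Keeping it as a hypothesis lets the induction supply its own induction hypothesis
  here.\<close>

lemma has_real_derivative_anom_coeff:
  assumes "\<And>\<beta>. \<beta> \<in> anom_domain \<xi> \<Longrightarrow> anom_coeff \<xi> k \<beta> = \<beta> * anom_W \<xi> \<beta> / fact k"
    and "\<alpha> \<in> anom_domain \<xi>"
  shows "(anom_coeff \<xi> k has_real_derivative
           (anom_W \<xi> \<alpha> + anom_W \<xi> \<alpha> / (\<alpha> * (1 + anom_W \<xi> \<alpha>))) / fact k) (at \<alpha>)"
  by (rule has_field_derivative_transform_within_open
             [OF DERIV_cdivide[OF has_real_derivative_mult_anom_W] open_anom_domain])
     (use assms in auto)

lemma anom_coeff_eq:
  assumes "\<alpha> \<in> anom_domain \<xi>"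
  shows "anom_coeff \<xi> (Suc (Suc k)) \<alpha> = \<alpha> * anom_W \<xi> \<alpha> / fact (Suc (Suc k))"
  using assms
\<comment> \<open>\<alpha> is generalized because the induction hypothesis gets differentiated and
  so must hold near the given point.\<close>
proof (induction k arbitrary: \<alpha>)
  case 0
  then show ?case
    by (simp add: anom_dim_operator_anom_dim numeral_2_eq_2)
next
  case (Suc k)
  let ?n = "Suc (Suc k)"
  let ?D = "anom_W \<xi> \<alpha> + anom_W \<xi> \<alpha> / (\<alpha> * (1 + anom_W \<xi> \<alpha>))"
  have "deriv (anom_coeff \<xi> ?n) \<alpha> = ?D / fact ?n"
    by (rule DERIV_imp_deriv, rule has_real_derivative_anom_coeff) (use Suc in auto)
  then have "anom_coeff \<xi> (Suc ?n) \<alpha> =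
      anom_dim \<xi> \<alpha> * (\<alpha> * (?D / fact ?n) - \<alpha> * anom_W \<xi> \<alpha> / fact ?n) / real (Suc ?n)"
    using Suc.IH[OF Suc.prems] by (simp only: anom_coeff.simps)
  \<comment> \<open>By linearity the factor 1 / \<open>fact ?n\<close> leaves the operator; it joins
    the recursion's divisor to form the next factorial.\<close>
  also have "\<dots> = anom_dim \<xi> \<alpha> * (\<alpha> * ?D - \<alpha> * anom_W \<xi> \<alpha>) / (fact ?n * real (Suc ?n))"
    by (simp only: times_divide_eq_right diff_divide_distrib[symmetric] divide_divide_eq_left)
  also have "\<dots> = \<alpha> * anom_W \<xi> \<alpha> / fact (Suc ?n)"
    unfolding anom_dim_operator_mult_anom_W[OF Suc.prems] fact_Suc[of ?n]
    by (simp only: mult.commute)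
  finally show ?case .
qed

text \<open>\<open>deriv\<close> is total, so this certifies that the recursion uses genuine
  derivatives on the domain.\<close>

lemma anom_coeff_field_differentiable:
  assumes "\<alpha> \<in> anom_domain \<xi>"
  shows "anom_coeff \<xi> (Suc k) field_differentiable at \<alpha>"
proof (cases k)
  case 0
  then show ?thesis
    using has_real_derivative_anom_dim[OF assms] by (auto simp: field_differentiable_def)
next
  case (Suc m)
  then show ?thesis
    using has_real_derivative_anom_coeff[OF anom_coeff_eq assms]
    by (auto simp: field_differentiable_def)
qed

text \<open>Since \<gamma> = \<alpha> + \<alpha> w, every coefficient is \<alpha> w / j!, except for
  an additional \<alpha> at j = 1. The series is thus \<alpha> L plus \<alpha> w times the
  exponential series without its constant term.\<close>

lemma anom_coeff_sums:
  assumes "\<alpha> \<in> anom_domain \<xi>"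
  shows "(\<lambda>j. anom_coeff \<xi> (Suc j) \<alpha> * L ^ Suc j) sums
           (\<alpha> * L + \<alpha> * (exp L - 1) * anom_W \<xi> \<alpha>)"
proof -
  have "(\<lambda>n. L ^ n / fact n) sums exp L"
    using exp_converges[of L] by (simp add: divide_inverse mult.commute)
  then have "(\<lambda>j. L ^ Suc j / fact (Suc j)) sums (exp L - 1)"
    by (subst sums_Suc_iff) simp
  \<comment> \<open>The additional linear term enters as a series supported at index 0, which stands
    for the power \<open>L ^ Suc 0\<close>.\<close>
  from sums_add[OF sums_single[of 0 "\<lambda>_. \<alpha> * L"] sums_mult[OF this, of "\<alpha> * anom_W \<xi> \<alpha>"]]
  have "(\<lambda>j. (if j = 0 then \<alpha> * L else 0) + \<alpha> * anom_W \<xi> \<alpha> * (L ^ Suc j / fact (Suc j)))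
          sums (\<alpha> * L + \<alpha> * anom_W \<xi> \<alpha> * (exp L - 1))"
    by simp
  moreover have "anom_coeff \<xi> (Suc j) \<alpha> * L ^ Suc j =
      (if j = 0 then \<alpha> * L else 0) + \<alpha> * anom_W \<xi> \<alpha> * (L ^ Suc j / fact (Suc j))" for j
  proof (cases j)
    case 0
    then show ?thesis
      by (simp add: anom_dim_eq algebra_simps)
  next
    case (Suc m)
    then show ?thesis
      using anom_coeff_eq[OF assms, of m] by (simp del: anom_coeff.simps)
  qed
  ultimately show ?thesis
    by (simp add: mult_ac)
qed

lemma self_energy_eq:
  assumes "\<alpha> \<in> anom_domain \<xi>"
  shows "self_energy \<xi> \<alpha> (exp L) = \<alpha> * L + \<alpha> * (exp L - 1) * anom_W \<xi> \<alpha>"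
  using sums_unique[OF anom_coeff_sums[OF assms, of L]] by (simp add: self_energy_def)

theorem claim7p1:
  fixes \<xi> \<alpha> :: real
  assumes "\<alpha> > 0" and "\<xi> * exp (- 1 / \<alpha>) > - exp (- 1)"
  shows "(\<forall>k\<ge>1. anom_coeff \<xi> k field_differentiable at \<alpha>)
    \<and> anom_dim \<xi> \<alpha> + anom_dim \<xi> \<alpha> * (anom_dim \<xi> \<alpha> - \<alpha> * deriv (anom_dim \<xi>) \<alpha>) = \<alpha>
    \<and> (\<forall>j\<ge>2. fact j * anom_coeff \<xi> j \<alpha> = \<alpha> * lambert_W (\<xi> * exp (- 1 / \<alpha>)))
    \<and> (\<forall>L::real. summable (\<lambda>j. anom_coeff \<xi> (Suc j) \<alpha> * L ^ Suc j)
         \<and> self_energy \<xi> \<alpha> (exp L)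
             = \<alpha> * L + \<alpha> * (exp L - 1) * lambert_W (\<xi> * exp (- 1 / \<alpha>)))
    \<and> (\<forall>(q2::real) (mu2::real) L. q2 < 0 \<longrightarrow> mu2 > 0 \<longrightarrow> L = ln (- q2 / mu2) \<longrightarrow>
         self_energy \<xi> \<alpha> (exp L)
           = \<alpha> * ln (- q2 / mu2)
             - \<alpha> * (1 + q2 / mu2) * lambert_W (\<xi> * exp (- 1 / \<alpha>)))"
proof (intro conjI allI impI)
  have dom: "\<alpha> \<in> anom_domain \<xi>"
    using assms by (simp add: anom_domain_def)
  show "anom_coeff \<xi> k field_differentiable at \<alpha>" if "k \<ge> 1" for k
    using anom_coeff_field_differentiable[OF dom, of "k - 1"] that by simp
  \<comment> \<open>The product is the negated operator value -\<alpha> w, leaving \<alpha> (1 + w)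
    - \<alpha> w.\<close>
  show "anom_dim \<xi> \<alpha> + anom_dim \<xi> \<alpha> * (anom_dim \<xi> \<alpha> - \<alpha> * deriv (anom_dim \<xi>) \<alpha>) = \<alpha>"
    using anom_dim_operator_anom_dim[OF dom] anom_dim_eq[of \<xi> \<alpha>] by (simp add: algebra_simps)
  show "fact j * anom_coeff \<xi> j \<alpha> = \<alpha> * lambert_W (\<xi> * exp (- 1 / \<alpha>))" if "j \<ge> 2" for j
  proof -
    from le_Suc_ex[OF that] obtain k where "j = Suc (Suc k)"
      by auto
    then show ?thesis
      using anom_coeff_eq[OF dom, of k]
      by (simp del: anom_coeff.simps fact_Suc add: anom_W_def)
  qed
  show "summable (\<lambda>j. anom_coeff \<xi> (Suc j) \<alpha> * L ^ Suc j)" for L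
    using anom_coeff_sums[OF dom] by (rule sums_summable)
  show "self_energy \<xi> \<alpha> (exp L) =
          \<alpha> * L + \<alpha> * (exp L - 1) * lambert_W (\<xi> * exp (- 1 / \<alpha>))" for L
    using self_energy_eq[OF dom] by (simp add: anom_W_def)
  show "self_energy \<xi> \<alpha> (exp L) = \<alpha> * ln (- q2 / mu2)
          - \<alpha> * (1 + q2 / mu2) * lambert_W (\<xi> * exp (- 1 / \<alpha>))"
    if "q2 < 0" "mu2 > 0" "L = ln (- q2 / mu2)" for q2 mu2 L :: real
  proof -
    \<comment> \<open>The sign conditions make the argument of \<open>ln\<close> positive; hence
      \<open>exp L - 1\<close> is \<open>- (1 + q2 / mu2)\<close>.\<close>
    have "exp L = - q2 / mu2"
      using that by (simp add: divide_neg_pos)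
    then show ?thesis
      using self_energy_eq[OF dom, of L] that(3) by (simp add: anom_W_def algebra_simps)
  qed
qed

end
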